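(* Let $A\in\mathbb{R}^{n\times n}$ and let $AV = VH_k + r_k e_k^T$ be a $k$-step randomized Arnoldi factorization obtained from the starting vector $v_1$ with sketching matrix $\Omega$. Then $H_k$ is the representation in $\mathbb{R}^k$, with respect to the basis $V$, of the operator $P^{\Omega}_{\mathcal{K}_k} A P^{\Omega}_{\mathcal{K}_k}$ restricted to $\mathcal{K}_k$, that is, $$P^{\Omega}_{\mathcal{K}_k} A P^{\Omega}_{\mathcal{K}_k}\, x = V H_k y \quad\text{whenever } x = Vy,\ y\in\mathbb{R}^k.$$ Moreover, the characteristic polynomial $\hat p_k$ of $H_k$ minimizes $\|\Omega p(A)v_1\|$ over the set $\mathcal{PM}_k$ of all monic polynomials $p$ of degree $k$: $$\hat p_k = \arg\min_{p\in\mathcal{PM}_k}\|\Omega p(A) v_1\|.$$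
   Context: All inner products and norms are Euclidean. For $\Omega\in\mathbb{R}^{d\times n}$: $\Omega$ is an $\epsilon$-embedding for a subspace $\mathcal{S}\subset\mathbb{R}^n$ (with $\epsilon\in[0,1)$) if $(1-\epsilon)\|x\|^2\le\|\Omega x\|^2\le(1+\epsilon)\|x\|^2$ for all $x\in\mathcal{S}$. Vectors $x,y$ are $\Omega$-orthogonal if $(\Omega x)^T(\Omega y)=0$; a matrix $V$ with $k$ columns is $\Omega$-orthonormal if $(\Omega V)^T(\Omega V)=I_k$. Randomized Arnoldi factorization: given $v_1\in\mathbb{R}^n$ with $\|\Omega v_1\|=1$, let $\mathcal{K}_k=\mathrm{span}\{v_1,Av_1,\dots,A^{k-1}v_1\}$ be of dimension $k$ and let $\Omega$ be an $\epsilon$-embedding for $\mathrm{span}\{\mathcal{K}_k, A\mathcal{K}_k\}$. A ($k$-step) randomized Arnoldi factorization is a relation $AV = VH_k + r_k e_k^T$, where $V\in\mathbb{R}^{n\times k}$ is an $\Omega$-orthonormal basis of $\mathcal{K}_k$ with $V(:,1)=v_1$, $H_k\in\mathbb{R}^{k\times k}$ is upper Hessenberg with positive subdiagonal entries, $r_k=h_{k+1,k}v_{k+1}\in\mathcal{K}_{k+1}$ is $\Omega$-orthogonal to $\mathcal{K}_k$, and $e_k$ is the $k$-th canonical vector of $\mathbb{R}^k$. The projector $P^\Omega_{\mathcal{K}_k}$ onto $\mathcal{K}_k$ is defined by $P^\Omega_{\mathcal{K}_k}x=\arg\min_{y\in\mathcal{K}_k}\|\Omega(x-y)\|$ for $x\in\mathbb{R}^n$;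 equivalently $P^\Omega_{\mathcal{K}_k}=V(\Omega V)^{\dagger}\Omega$, which here equals $V(\Omega V)^T\Omega$. Polynomials have real coefficients. *)

theory Defs
  imports "Jordan_Normal_Form.Char_Poly" "Jordan_Normal_Form.DL_Rank"
    "HOL-Computational_Algebra.Polynomial" Complex_Main
begin

definition euclid_norm :: "real vec \<Rightarrow> real" where
  "euclid_norm x = sqrt (x \<bullet> x)"

abbreviation rspan :: "nat \<Rightarrow> real vec set \<Rightarrow> real vec set" where
  "rspan n S \<equiv> LinearCombinations.module.span class_ring (module_vec TYPE(real) n) S"

abbreviation rlin_indpt :: "nat \<Rightarrow> real vec set \<Rightarrow> bool" where
  "rlin_indpt n S \<equiv> \<not> LinearCombinations.module.lin_dep class_ring (module_vec TYPE(real) n) S"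

abbreviation rdim :: "nat \<Rightarrow> real vec set \<Rightarrow> nat" where
  "rdim n W \<equiv> vectorspace.dim class_ring
     (module_vec TYPE(real) n \<lparr>carrier := W\<rparr>)"

text \<open>A list rather than a set of vectors, so that the columns of a matrix with a repeated
  column do not count as a basis.\<close>

definition is_basis_of :: "nat \<Rightarrow> real vec list \<Rightarrow> real vec set \<Rightarrow> bool" where
  "is_basis_of n vs W \<longleftrightarrow> set vs \<subseteq> carrier_vec n \<and> distinct vs \<and>
     rlin_indpt n (set vs) \<and> rspan n (set vs) = W"

definition krylov :: "nat \<Rightarrow> real mat \<Rightarrow> real vec \<Rightarrow> nat \<Rightarrow> real vec set" where
  "krylov n A v k = rspan n ((\<lambda>i. (A ^\<^sub>m i) *\<^sub>v v) ` {..<k})"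

definition eps_embedding :: "real \<Rightarrow> real mat \<Rightarrow> real vec set \<Rightarrow> bool" where
  "eps_embedding eps Om W \<longleftrightarrow> 0 \<le> eps \<and> eps < 1 \<and>
     (\<forall>x\<in>W. (1 - eps) * (euclid_norm x)\<^sup>2 \<le> (euclid_norm (Om *\<^sub>v x))\<^sup>2 \<and>
             (euclid_norm (Om *\<^sub>v x))\<^sup>2 \<le> (1 + eps) * (euclid_norm x)\<^sup>2)"

definition sketch_orthogonal :: "real mat \<Rightarrow> real vec \<Rightarrow> real vec \<Rightarrow> bool" where
  "sketch_orthogonal Om x y \<longleftrightarrow> (Om *\<^sub>v x) \<bullet> (Om *\<^sub>v y) = 0"

definition sketch_orthonormal :: "real mat \<Rightarrow> real mat \<Rightarrow> bool" where
  "sketch_orthonormal Om V \<longleftrightarrow> transpose_mat (Om * V) * (Om * V) = 1\<^sub>m (dim_col V)"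

definition upper_hessenberg_pos :: "real mat \<Rightarrow> bool" where
  "upper_hessenberg_pos H \<longleftrightarrow>
     (\<forall>i<dim_row H. \<forall>j<dim_col H. j + 1 < i \<longrightarrow> H $$ (i, j) = 0) \<and>
     (\<forall>j. j + 1 < dim_row H \<longrightarrow> 0 < H $$ (j + 1, j))"

definition outer :: "real vec \<Rightarrow> real vec \<Rightarrow> real mat" where
  "outer x y = mat_of_cols (dim_vec x) [x] * mat_of_rows (dim_vec y) [y]"

text \<open>The vector \<open>r\<close> stands for the product of \<open>h\<^sub>k\<^sub>+\<^sub>1\<^sub>,\<^sub>k\<close> and \<open>v\<^sub>k\<^sub>+\<^sub>1\<close>; it may be zero (breakdown).
  Indices start at 0, so that \<open>e\<^sub>k\<close> is \<open>unit_vec k (k - 1)\<close> and \<open>V(:,1)\<close> is \<open>col V 0\<close>.\<close>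

definition rand_arnoldi ::
  "nat \<Rightarrow> nat \<Rightarrow> nat \<Rightarrow> real \<Rightarrow> real mat \<Rightarrow> real mat \<Rightarrow> real vec \<Rightarrow>
   real mat \<Rightarrow> real mat \<Rightarrow> real vec \<Rightarrow> bool" where
  "rand_arnoldi n d k eps Om A v1 V H r \<longleftrightarrow>
     1 \<le> k \<and> Om \<in> carrier_mat d n \<and> A \<in> carrier_mat n n \<and> v1 \<in> carrier_vec n \<and>
     V \<in> carrier_mat n k \<and> H \<in> carrier_mat k k \<and> r \<in> carrier_vec n \<and>
     euclid_norm (Om *\<^sub>v v1) = 1 \<and>
     rdim n (krylov n A v1 k) = k \<and>
     eps_embedding eps Om
       (rspan n (krylov n A v1 k \<union> (\<lambda>x. A *\<^sub>v x) ` krylov n A v1 k)) \<and>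
     A * V = V * H + outer r (unit_vec k (k - 1)) \<and>
     is_basis_of n (cols V) (krylov n A v1 k) \<and> sketch_orthonormal Om V \<and>
     col V 0 = v1 \<and>
     upper_hessenberg_pos H \<and>
     r \<in> krylov n A v1 (k + 1) \<and>
     (\<forall>x \<in> krylov n A v1 k. sketch_orthogonal Om r x)"

text \<open>The minimiser exists and is unique for a subspace on which \<open>Om\<close> is injective, e.g. one
  for which \<open>Om\<close> is an embedding.\<close>

definition sketch_proj :: "real mat \<Rightarrow> real vec set \<Rightarrow> real vec \<Rightarrow> real vec" where
  "sketch_proj Om W x = arg_min_on (\<lambda>y. euclid_norm (Om *\<^sub>v (x - y))) W"

definition mat_poly :: "nat \<Rightarrow> real poly \<Rightarrow> real mat \<Rightarrow> real mat" where
  "mat_poly n p A = mat n n (\<lambda>(i, j). \<Sum>l\<le>degree p. coeff p l * (A ^\<^sub>m l) $$ (i, j))"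

definition monic_polys :: "nat \<Rightarrow> real poly set" where
  "monic_polys k = {p. degree p = k \<and> lead_coeff p = 1}"

end

theory Submission
  imports Defs
begin

text \<open>
  Both claims come from reading the recurrence \<open>A V = V H + r e\<^sub>k\<^sup>T\<close> in the coordinates given by \<open>V\<close>.
  Since \<open>Om * V\<close> has orthonormal columns and \<open>Om r\<close> is orthogonal to all of them, every vector
  \<open>V y + c r\<close> satisfies \<open>\<parallel>Om (V y + c r)\<parallel>\<^sup>2 = \<parallel>y\<parallel>\<^sup>2 + c\<^sup>2 \<parallel>Om r\<parallel>\<^sup>2\<close>
  (\<open>sketch_norm_split\<close>), and so its sketched projection onto the Krylov space is \<open>V y\<close>
  (\<open>sketch_proj_eq\<close>). As \<open>A V y = V H y + y\<^sub>k r\<close>, the compression of \<open>A\<close> to the Krylov space acts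
  as \<open>H\<close>.

  For the optimality of the characteristic polynomial, \<open>v\<^sub>1 = V e\<^sub>1\<close>, and the Hessenberg form of \<open>H\<close>
  gives \<open>H\<^sup>l e\<^sub>1\<close> a vanishing last entry for \<open>l < k - 1\<close>. Hence the residual enters only in the
  \<open>k\<close>-th power: \<open>A\<^sup>l v\<^sub>1 = V H\<^sup>l e\<^sub>1\<close> for \<open>l < k\<close> and \<open>A\<^sup>k v\<^sub>1 = V H\<^sup>k e\<^sub>1 + c r\<close>. For each monic \<open>p\<close> of
  degree \<open>k\<close> this gives \<open>p(A) v\<^sub>1 = V p(H) e\<^sub>1 + c r\<close> with one and the same \<open>c\<close>
  (\<open>monic_poly_mult_start\<close>), so that minimising \<open>\<parallel>Om p(A) v\<^sub>1\<parallel>\<close> is minimising \<open>\<parallel>p(H) e\<^sub>1\<parallel>\<close>. The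
  characteristic polynomial makes this norm zero by the Cayley-Hamilton theorem. No other monic
  polynomial of degree \<open>k\<close> does: the positive subdiagonal makes \<open>e\<^sub>1, H e\<^sub>1, \<dots>, H\<^sup>k\<^sup>-\<^sup>1 e\<^sub>1\<close> triangular
  with nonzero diagonal, so that two monic annihilators of \<open>e\<^sub>1\<close>, whose difference has degree below
  \<open>k\<close>, are equal (\<open>monic_annihilator_eq_char_poly\<close>).
\<close>

section \<open>Polynomials evaluated along a sequence\<close>

text \<open>The linear functional that sends \<open>x\<^sup>l\<close> to \<open>s l\<close>. Applied to the sequence of a fixed entry of
  \<open>A\<^sup>l\<close> or of \<open>A\<^sup>l v\<close>, it is the same entry of \<open>p(A)\<close> or of \<open>p(A) v\<close>; in this form, computing with
  \<open>p(A)\<close> needs scalar sums only.\<close>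

definition umbral :: "(nat \<Rightarrow> 'a::comm_ring_1) \<Rightarrow> 'a poly \<Rightarrow> 'a" where
  "umbral s p = (\<Sum>l\<le>degree p. coeff p l * s l)"

lemma umbral_atMost:
  assumes "degree p \<le> N"
  shows "umbral s p = (\<Sum>l\<le>N. coeff p l * s l)"
  unfolding umbral_def using assms
  by (intro sum.mono_neutral_left) (auto simp: coeff_eq_0)

lemma umbral_0 [simp]: "umbral s 0 = 0"
  by (simp add: umbral_def)

lemma umbral_add: "umbral s (p + q) = umbral s p + umbral s q"
proof -
  let ?N = "max (degree p) (degree q)"
  have "umbral s (p + q) = (\<Sum>l\<le>?N. coeff (p + q) l * s l)"
    by (rule umbral_atMost) (rule degree_add_le_max)
  then show ?thesis
    by (simp add: umbral_atMost[of _ ?N] distrib_right sum.distrib)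
qed

lemma umbral_smult: "umbral s (Polynomial.smult c p) = c * umbral s p"
  by (simp add: umbral_atMost[of _ "degree p"] degree_smult_le sum_distrib_left mult.assoc)

lemma umbral_sum: "umbral s (sum f I) = (\<Sum>i\<in>I. umbral s (f i))"
  by (induction I rule: infinite_finite_induct) (simp_all add: umbral_add)

lemma umbral_diff: "umbral s (p - q) = umbral s p - umbral s q"
  using umbral_add[of s "p - q" q] by simp

text \<open>Multiplication by the indeterminate is dual to the shift of the sequence. For \<open>s l = A\<^sup>l v\<close>, read
  entrywise, the shift replaces \<open>v\<close> by \<open>A v\<close>, which turns products of polynomials into products of
  matrices.\<close>

lemma umbral_pCons_0: "umbral s (pCons 0 p) = umbral (\<lambda>l. s (Suc l)) p"
proof -
  have "umbral s (pCons 0 p) = (\<Sum>l\<le>Suc (degree p). coeff (pCons 0 p) l * s l)"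
    by (rule umbral_atMost) (rule degree_pCons_le)
  then show ?thesis
    by (simp add: umbral_def sum.atMost_Suc_shift del: sum.atMost_Suc)
qed

lemma umbral_linear_combination:
  "umbral (\<lambda>l. \<Sum>m\<in>M. c m * s m l) p = (\<Sum>m\<in>M. c m * umbral (s m) p)"
  unfolding umbral_def sum_distrib_left
  by (subst sum.swap) (simp add: mult.left_commute)

section \<open>The Cayley-Hamilton theorem\<close>

lemma index_mult_mat_vec_sum:
  assumes "B \<in> carrier_mat n m" "w \<in> carrier_vec m" "i < n"
  shows "(B *\<^sub>v w) $ i = (\<Sum>j<m. B $$ (i, j) * w $ j)"
  using assms by (auto simp: scalar_prod_def lessThan_atLeast0 intro!: sum.cong)

lemma index_mult_mat_sum:
  assumes "B \<in> carrier_mat n m" "C \<in> carrier_mat m k" "i < n" "j < k"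
  shows "(B * C) $$ (i, j) = (\<Sum>l<m. B $$ (i, l) * C $$ (l, j))"
  using assms by (auto simp: scalar_prod_def lessThan_atLeast0 intro!: sum.cong)

text \<open>The adjugate proof. Let the polynomial ring act on vectors with \<open>x\<close> acting as \<open>A\<close>. The columns
  of \<open>x I - A\<close>, read as combinations of the basis vectors \<open>e\<^sub>m\<close> with polynomial coefficients, are
  then all zero, since column \<open>l\<close> is \<open>A e\<^sub>l - (\<Sum>m. A\<^sub>m\<^sub>l e\<^sub>m)\<close>. So are their combinations, and
  multiplying by the adjugate yields \<open>\<chi>(x) e\<^sub>j\<close>, that is \<open>\<chi>(A) e\<^sub>j\<close>, for the characteristic
  polynomial \<open>\<chi>\<close>. Only the entry \<open>i\<close> of each vector is recorded.\<close>

theorem Cayley_Hamilton: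
  fixes A :: "'a::comm_ring_1 mat"
  assumes A: "A \<in> carrier_mat n n" and i: "i < n" and j: "j < n"
  shows "umbral (\<lambda>k. (A ^\<^sub>m k) $$ (i, j)) (char_poly A) = 0"
proof -
  let ?X = "char_poly_matrix A"
  let ?Y = "adj_mat ?X"
  define s where "s m k = (A ^\<^sub>m k) $$ (i, m)" for m k
  have X: "?X \<in> carrier_mat n n" and Y: "?Y \<in> carrier_mat n n"
    using A adj_mat(1)[of ?X n] by simp_all
  have X_entry: "?X $$ (m, l) * q =
      (if m = l then pCons 0 q else 0) - Polynomial.smult (A $$ (m, l)) q" if "m < n" "l < n" for m l q
    using A that by (auto simp: char_poly_matrix_def)
  \<comment> \<open>Column \<open>l\<close> of \<open>x I - A\<close>, multiplied by any polynomial \<open>q\<close>, acts as zero.\<close>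
  have kill: "(\<Sum>m<n. umbral (s m) (?X $$ (m, l) * q)) = 0" if l: "l < n" for l q
  proof -
    have shift: "s l (Suc k) = (\<Sum>m<n. A $$ (m, l) * s m k)" for k
      using index_mult_mat_sum[OF _ A i l, of "A ^\<^sub>m k"] A
      by (simp add: s_def pow_carrier_mat mult.commute)
    have "umbral (s m) (?X $$ (m, l) * q) =
        (if m = l then umbral (\<lambda>k. s l (Suc k)) q else 0) - A $$ (m, l) * umbral (s m) q"
      if "m < n" for m
      using X_entry[OF that l] by (auto simp: umbral_diff umbral_smult umbral_pCons_0)
    then have "(\<Sum>m<n. umbral (s m) (?X $$ (m, l) * q)) =
        umbral (\<lambda>k. s l (Suc k)) q - (\<Sum>m<n. A $$ (m, l) * umbral (s m) q)"
      using l by (simp add: sum_subtractf)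
    then show ?thesis
      by (simp add: shift umbral_linear_combination)
  qed
  have adj: "(\<Sum>l<n. ?X $$ (m, l) * ?Y $$ (l, j)) = (if m = j then char_poly A else 0)"
    if "m < n" for m
    using index_mult_mat_sum[OF X Y that j, symmetric] adj_mat(2)[OF X] that j
    by (simp add: char_poly_def)
  have "0 = (\<Sum>l<n. \<Sum>m<n. umbral (s m) (?X $$ (m, l) * ?Y $$ (l, j)))"
    by (simp add: kill)
  also have "\<dots> = (\<Sum>m<n. umbral (s m) (\<Sum>l<n. ?X $$ (m, l) * ?Y $$ (l, j)))"
    by (subst sum.swap) (simp add: umbral_sum)
  also have "\<dots> = (\<Sum>m<n. if m = j then umbral (s m) (char_poly A) else 0)"
    by (intro sum.cong refl) (simp add: adj)
  also have "\<dots> = umbral (s j) (char_poly A)"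
    using j by simp
  finally show ?thesis
    by (simp add: s_def[abs_def])
qed

lemma index_mat_poly_mult_vec:
  assumes A: "A \<in> carrier_mat n n" and v: "v \<in> carrier_vec n" and i: "i < n"
  shows "(mat_poly n p A *\<^sub>v v) $ i = umbral (\<lambda>l. (A ^\<^sub>m l *\<^sub>v v) $ i) p"
proof -
  have "(mat_poly n p A *\<^sub>v v) $ i = (\<Sum>j<n. v $ j * umbral (\<lambda>l. (A ^\<^sub>m l) $$ (i, j)) p)"
    using index_mult_mat_vec_sum[OF _ v i, of "mat_poly n p A"] i
    by (simp add: mat_poly_def umbral_def mult.commute)
  also have "\<dots> = umbral (\<lambda>l. \<Sum>j<n. v $ j * (A ^\<^sub>m l) $$ (i, j)) p"
    by (rule umbral_linear_combination[symmetric])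
  also have "(\<lambda>l. \<Sum>j<n. v $ j * (A ^\<^sub>m l) $$ (i, j)) = (\<lambda>l. (A ^\<^sub>m l *\<^sub>v v) $ i)"
    using index_mult_mat_vec_sum[OF _ v i] A by (auto simp: pow_carrier_mat mult.commute)
  finally show ?thesis .
qed

lemma mat_poly_carrier [simp]: "mat_poly n p A \<in> carrier_mat n n"
  by (simp add: mat_poly_def)

lemma char_poly_annihilates:
  assumes A: "A \<in> carrier_mat n n" and v: "v \<in> carrier_vec n"
  shows "mat_poly n (char_poly A) A *\<^sub>v v = 0\<^sub>v n"
proof -
  have "mat_poly n (char_poly A) A $$ (i, j) = 0" if "i < n" "j < n" for i j
    using Cayley_Hamilton[OF A that] that by (simp add: mat_poly_def umbral_def)
  then have "mat_poly n (char_poly A) A = 0\<^sub>m n n"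
    by (intro eq_matI) (auto simp: mat_poly_def)
  then show ?thesis
    using v by (intro eq_vecI) (auto simp: scalar_prod_def)
qed

lemma char_poly_in_monic_polys:
  assumes "A \<in> carrier_mat k k"
  shows "char_poly A \<in> monic_polys k"
  using degree_monic_char_poly[OF assms] by (simp add: monic_polys_def)

section \<open>Krylov sequences of Hessenberg matrices\<close>

lemma pow_mat_mult_vec_carrier:
  assumes "A \<in> carrier_mat n n" "v \<in> carrier_vec n"
  shows "A ^\<^sub>m l *\<^sub>v v \<in> carrier_vec n"
  by (rule mult_mat_vec_carrier[OF pow_carrier_mat[OF assms(1)] assms(2)])

lemma pow_mat_Suc_mult_vec:
  fixes A :: "'a::comm_ring_1 mat"
  assumes A: "A \<in> carrier_mat n n" and v: "v \<in> carrier_vec n"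
  shows "A ^\<^sub>m Suc l *\<^sub>v v = A *\<^sub>v (A ^\<^sub>m l *\<^sub>v v)"
proof -
  have "A ^\<^sub>m Suc l = A * A ^\<^sub>m l"
  proof (induction l)
    case (Suc l)
    have "A ^\<^sub>m Suc (Suc l) = A * A ^\<^sub>m l * A"
      using Suc by simp
    then show ?case
      using A by (simp add: assoc_mult_mat[of _ n n _ n _ n] pow_carrier_mat)
  qed (use A in simp)
  then show ?thesis
    using A v by (simp add: assoc_mult_mat_vec[of _ n n _ n] pow_carrier_mat)
qed

text \<open>One multiplication by a Hessenberg matrix pushes the last nonzero entry down by one row, and
  multiplies it by a subdiagonal entry.\<close>

lemma hessenberg_krylov_triangular:
  assumes H: "H \<in> carrier_mat k k" and hess: "upper_hessenberg_pos H" and l: "l < k"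
  shows "(\<forall>i<k. l < i \<longrightarrow> (H ^\<^sub>m l *\<^sub>v unit_vec k 0) $ i = 0) \<and>
    0 < (H ^\<^sub>m l *\<^sub>v unit_vec k 0) $ l"
  using l
proof (induction l)
  case 0
  then show ?case using H by simp
next
  case (Suc l)
  define w where "w = H ^\<^sub>m l *\<^sub>v unit_vec k 0"
  have w: "w \<in> carrier_vec k"
    unfolding w_def by (rule pow_mat_mult_vec_carrier[OF H unit_vec_carrier])
  have step: "H ^\<^sub>m Suc l *\<^sub>v unit_vec k 0 = H *\<^sub>v w"
    unfolding w_def by (rule pow_mat_Suc_mult_vec[OF H]) simp
  have w0: "\<And>j. j < k \<Longrightarrow> l < j \<Longrightarrow> w $ j = 0" and wl: "0 < w $ l"
    using Suc by (auto simp: w_def)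
  have Hz: "\<And>i j. i < k \<Longrightarrow> j < k \<Longrightarrow> j + 1 < i \<Longrightarrow> H $$ (i, j) = 0"
    and Hp: "0 < H $$ (Suc l, l)"
    using hess H Suc.prems by (auto simp: upper_hessenberg_pos_def)
  have "(H *\<^sub>v w) $ i = 0" if "i < k" "Suc l < i" for i
  proof -
    have "H $$ (i, j) * w $ j = 0" if "j < k" for j
      using w0[of j] Hz[of i j] \<open>i < k\<close> \<open>Suc l < i\<close> that by (cases "l < j") auto
    then show ?thesis
      unfolding index_mult_mat_vec_sum[OF H w \<open>i < k\<close>] by (intro sum.neutral) simp
  qed
  moreover have "(H *\<^sub>v w) $ Suc l = H $$ (Suc l, l) * w $ l"
  proof -
    have "H $$ (Suc l, j) * w $ j = (if j = l then H $$ (Suc l, l) * w $ l else 0)" if "j < k" for j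
      using w0[of j] Hz[of "Suc l" j] Suc.prems that by (cases "l < j") auto
    then have "(\<Sum>j<k. H $$ (Suc l, j) * w $ j) =
        (\<Sum>j<k. if j = l then H $$ (Suc l, l) * w $ l else 0)"
      by (intro sum.cong refl) simp
    then show ?thesis
      unfolding index_mult_mat_vec_sum[OF H w Suc.prems] using Suc.prems by simp
  qed
  ultimately show ?case
    unfolding step using Hp wl by simp
qed

text \<open>Row \<open>degree q\<close> of \<open>q(H) e\<^sub>1\<close> sees only the leading term of \<open>q\<close>, because the lower powers of
  \<open>H\<close> have not yet reached this row.\<close>

lemma hessenberg_krylov_independent:
  assumes H: "H \<in> carrier_mat k k" and hess: "upper_hessenberg_pos H"
    and deg: "degree q < k"
    and zero: "\<And>i. i < k \<Longrightarrow> umbral (\<lambda>l. (H ^\<^sub>m l *\<^sub>v unit_vec k 0) $ i) q = 0"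
  shows "q = 0"
proof -
  let ?m = "degree q"
  have "umbral (\<lambda>l. (H ^\<^sub>m l *\<^sub>v unit_vec k 0) $ ?m) q =
      (\<Sum>l\<le>?m. if l = ?m then lead_coeff q * (H ^\<^sub>m ?m *\<^sub>v unit_vec k 0) $ ?m else 0)"
    unfolding umbral_def
    using hessenberg_krylov_triangular[OF H hess] deg
    by (intro sum.cong refl) auto
  then have "lead_coeff q * (H ^\<^sub>m ?m *\<^sub>v unit_vec k 0) $ ?m = 0"
    using zero[OF deg] by simp
  then show ?thesis
    using hessenberg_krylov_triangular[OF H hess deg] by auto
qed

lemma monic_annihilator_eq_char_poly:
  assumes H: "H \<in> carrier_mat k k" and hess: "upper_hessenberg_pos H"
    and p: "p \<in> monic_polys k" and k: "0 < k"
    and zero: "mat_poly k p H *\<^sub>v unit_vec k 0 = 0\<^sub>v k"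
  shows "p = char_poly H"
proof -
  have u: "umbral (\<lambda>l. (H ^\<^sub>m l *\<^sub>v unit_vec k 0) $ i) p = 0"
    "umbral (\<lambda>l. (H ^\<^sub>m l *\<^sub>v unit_vec k 0) $ i) (char_poly H) = 0" if "i < k" for i
    using that index_mat_poly_mult_vec[OF H, of "unit_vec k 0" i p]
      index_mat_poly_mult_vec[OF H, of "unit_vec k 0" i "char_poly H"]
    by (simp_all add: zero char_poly_annihilates[OF H])
  have "p - char_poly H = 0"
  proof (rule hessenberg_krylov_independent[OF H hess])
    have "coeff (p - char_poly H) k = 0" "degree (p - char_poly H) \<le> k"
      using p char_poly_in_monic_polys[OF H] by (auto simp: monic_polys_def intro!: degree_diff_le)
    then show "degree (p - char_poly H) < k"
      using k by (metis le_neq_implies_less leading_coeff_0_iff degree_0)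
  qed (simp add: umbral_diff u)
  then show ?thesis by simp
qed

section \<open>Sketched least squares\<close>

lemma scalar_prod_self_nonneg: "0 \<le> (x :: real vec) \<bullet> x"
  by (simp add: scalar_prod_def sum_nonneg)

lemma scalar_prod_self_eq_0_iff:
  assumes "(x :: real vec) \<in> carrier_vec n"
  shows "x \<bullet> x = 0 \<longleftrightarrow> x = 0\<^sub>v n"
  using conjugate_square_eq_0_vec[OF assms] by simp

lemma euclid_norm_less_iff: "euclid_norm x < euclid_norm y \<longleftrightarrow> x \<bullet> x < y \<bullet> y"
  by (simp add: euclid_norm_def)

lemma scalar_prod_pythagoras:
  fixes a b :: "real vec"
  assumes "a \<in> carrier_vec n" "b \<in> carrier_vec n" "a \<bullet> b = 0"
  shows "(a + b) \<bullet> (a + b) = a \<bullet> a + b \<bullet> b"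
  using assms comm_scalar_prod[OF assms(1,2)]
  by (simp add: add_scalar_prod_distrib[of _ n] scalar_prod_add_distrib[of _ n])

lemma outer_mult_unit_vec:
  assumes "r \<in> carrier_vec n" "y \<in> carrier_vec k" "j < k"
  shows "outer r (unit_vec k j) *\<^sub>v y = y $ j \<cdot>\<^sub>v r"
proof -
  have "mat_of_rows k [unit_vec k j] *\<^sub>v y = vec 1 (\<lambda>_. y $ j)"
    using assms by (intro eq_vecI) auto
  moreover have "mat_of_cols n [r] *\<^sub>v vec 1 (\<lambda>_. y $ j) = y $ j \<cdot>\<^sub>v r"
    using assms by (intro eq_vecI) (auto simp: scalar_prod_def mat_of_cols_def)
  ultimately show ?thesis
    using assms assoc_mult_mat_vec[of "mat_of_cols n [r]" n 1 "mat_of_rows k [unit_vec k j]" k y]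
    by (simp add: outer_def mat_of_cols_carrier(1)[of n "[r]", simplified]
        mat_of_rows_carrier(1)[of k "[unit_vec k j]", simplified])
qed

section \<open>The randomized Arnoldi factorization\<close>

locale randomized_arnoldi =
  fixes n d k :: nat and eps :: real and Om A V H :: "real mat" and v1 r :: "real vec"
  assumes arnoldi: "rand_arnoldi n d k eps Om A v1 V H r"
begin

abbreviation K where "K \<equiv> krylov n A v1 k"
abbreviation e1 where "e1 \<equiv> unit_vec k 0"

lemma k_pos: "0 < k"
  and Om [simp]: "Om \<in> carrier_mat d n" and A [simp]: "A \<in> carrier_mat n n"
  and v1 [simp]: "v1 \<in> carrier_vec n" and V [simp]: "V \<in> carrier_mat n k"
  and H [simp]: "H \<in> carrier_mat k k" and r [simp]: "r \<in> carrier_vec n"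
  and hess: "upper_hessenberg_pos H"
  using arnoldi by (auto simp: rand_arnoldi_def)

lemma dims [simp]: "dim_row V = n" "dim_col V = k" "dim_vec r = n" "dim_row A = n" "dim_row H = k"
  by (rule carrier_matD[OF V] carrier_vecD[OF r] carrier_matD[OF A] carrier_matD[OF H])+

lemma add_zero_smult_r [simp]: "x \<in> carrier_vec n \<Longrightarrow> x + 0 \<cdot>\<^sub>v r = x"
  by (rule eq_vecI) simp_all

lemma V_mult_carrier [simp]: "y \<in> carrier_vec k \<Longrightarrow> V *\<^sub>v y \<in> carrier_vec n"
  by (rule mult_mat_vec_carrier[OF V])

lemma Om_mult_carrier [simp]: "x \<in> carrier_vec n \<Longrightarrow> Om *\<^sub>v x \<in> carrier_vec d"
  by (rule mult_mat_vec_carrier[OF Om])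

lemma krylov_eq: "K = {V *\<^sub>v y | y. y \<in> carrier_vec k}"
proof -
  have "K = vec_space.col_space n V"
    using arnoldi by (simp add: rand_arnoldi_def is_basis_of_def vec_space.col_space_def)
  then show ?thesis
    using vec_space.col_space_eq[OF V] V mult_mat_vec_carrier[OF V] by auto
qed

lemma sketch_isometry:
  assumes y: "y \<in> carrier_vec k" and z: "z \<in> carrier_vec k"
  shows "(Om *\<^sub>v (V *\<^sub>v y)) \<bullet> (Om *\<^sub>v (V *\<^sub>v z)) = y \<bullet> z"
proof -
  let ?B = "Om * V"
  have B: "?B \<in> carrier_mat d k" by (rule mult_carrier_mat[OF Om V])
  have "transpose_mat ?B * ?B = 1\<^sub>m k"
    using arnoldi V by (simp add: rand_arnoldi_def sketch_orthonormal_def)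
  then have "transpose_mat ?B *\<^sub>v (?B *\<^sub>v y) = y"
    using B y by (metis assoc_mult_mat_vec one_mult_mat_vec transpose_carrier_mat)
  then have "y \<bullet> z = (?B *\<^sub>v y) \<bullet> (?B *\<^sub>v z)"
    using transpose_vec_mult_scalar[OF B z, of "?B *\<^sub>v y"] B y by simp
  then show ?thesis
    using y z by (simp add: assoc_mult_mat_vec[OF Om V])
qed

lemma r_orthogonal:
  assumes "y \<in> carrier_vec k"
  shows "(Om *\<^sub>v (V *\<^sub>v y)) \<bullet> (Om *\<^sub>v r) = 0"
proof -
  have "V *\<^sub>v y \<in> K"
    using assms krylov_eq by auto
  then have "(Om *\<^sub>v r) \<bullet> (Om *\<^sub>v (V *\<^sub>v y)) = 0"
    using arnoldi by (auto simp: rand_arnoldi_def sketch_orthogonal_def)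
  then show ?thesis
    using assms by (subst comm_scalar_prod[of _ d]) auto
qed

text \<open>Pythagoras for the sketched inner product, in which \<open>V\<close> is an isometry and \<open>r\<close> is normal to the
  range of \<open>V\<close>. Both the projection and the minimisation over polynomials reduce to it.\<close>

lemma sketch_norm_split:
  assumes y: "y \<in> carrier_vec k"
  shows "(Om *\<^sub>v (V *\<^sub>v y + c \<cdot>\<^sub>v r)) \<bullet> (Om *\<^sub>v (V *\<^sub>v y + c \<cdot>\<^sub>v r)) =
    y \<bullet> y + c\<^sup>2 * ((Om *\<^sub>v r) \<bullet> (Om *\<^sub>v r))"
proof -
  let ?a = "Om *\<^sub>v (V *\<^sub>v y)" and ?b = "Om *\<^sub>v r"
  have a: "?a \<in> carrier_vec d" and b: "?b \<in> carrier_vec d"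
    using y by simp_all
  have "Om *\<^sub>v (V *\<^sub>v y + c \<cdot>\<^sub>v r) = ?a + c \<cdot>\<^sub>v ?b"
    using y by (simp add: mult_add_distrib_mat_vec[OF Om] mult_mat_vec[OF Om])
  then show ?thesis
    using a b scalar_prod_pythagoras[of ?a d "c \<cdot>\<^sub>v ?b"] r_orthogonal[OF y] sketch_isometry[OF y y]
    by (simp add: scalar_prod_smult_distrib[of _ d] smult_scalar_prod_distrib[of _ d]
        power2_eq_square)
qed

text \<open>The sketched distance from \<open>V y + c r\<close> to \<open>V z\<close> has square \<open>\<parallel>y - z\<parallel>\<^sup>2\<close> plus a constant. Since
  \<open>sketch_proj\<close> picks an arbitrary minimiser, the proof has to show that \<open>V y\<close> is the only one.\<close>

lemma sketch_proj_eq: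
  assumes y: "y \<in> carrier_vec k"
  shows "sketch_proj Om K (V *\<^sub>v y + c \<cdot>\<^sub>v r) = V *\<^sub>v y"
proof -
  let ?x = "V *\<^sub>v y + c \<cdot>\<^sub>v r"
  let ?f = "\<lambda>w. euclid_norm (Om *\<^sub>v (?x - w))"
  let ?R = "c\<^sup>2 * ((Om *\<^sub>v r) \<bullet> (Om *\<^sub>v r))"
  have f: "(Om *\<^sub>v (?x - V *\<^sub>v z)) \<bullet> (Om *\<^sub>v (?x - V *\<^sub>v z)) = (y - z) \<bullet> (y - z) + ?R"
    if z: "z \<in> carrier_vec k" for z
  proof -
    have "?x - V *\<^sub>v z = V *\<^sub>v (y - z) + c \<cdot>\<^sub>v r"
      using y z by (intro eq_vecI) (simp_all add: mult_minus_distrib_mat_vec[OF V] del: index_mult_mat_vec)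
    then show ?thesis
      using sketch_norm_split[of "y - z" c] y z by simp
  qed
  have fy: "(Om *\<^sub>v (?x - V *\<^sub>v y)) \<bullet> (Om *\<^sub>v (?x - V *\<^sub>v y)) = ?R"
    using f[OF y] y by simp
  have less: "?f (V *\<^sub>v y) < ?f (V *\<^sub>v z)" if z: "z \<in> carrier_vec k" "z \<noteq> y" for z
  proof -
    have "y - z \<noteq> 0\<^sub>v k"
    proof
      assume "y - z = 0\<^sub>v k"
      then have "y $ i - z $ i = 0" if "i < k" for i
        using that y z by (metis carrier_vecD index_minus_vec(1) index_zero_vec(1))
      then have "z = y" using y z by (intro eq_vecI) auto
      then show False using z by simp
    qed
    then have "(y - z) \<bullet> (y - z) \<noteq> 0"
      using scalar_prod_self_eq_0_iff[of "y - z" k] y z by auto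
    then show ?thesis
      using scalar_prod_self_nonneg[of "y - z"]
      unfolding euclid_norm_less_iff f[OF z(1)] fy by linarith
  qed
  have yK: "V *\<^sub>v y \<in> K"
    using y krylov_eq by auto
  have "is_arg_min ?f (\<lambda>w. w \<in> K) w \<longleftrightarrow> w = V *\<^sub>v y" for w
  proof
    assume w: "is_arg_min ?f (\<lambda>w. w \<in> K) w"
    then obtain z where z: "z \<in> carrier_vec k" "w = V *\<^sub>v z"
      using krylov_eq by (auto simp: is_arg_min_def)
    have "\<not> ?f (V *\<^sub>v y) < ?f w"
      using w yK unfolding is_arg_min_def by blast
    then show "w = V *\<^sub>v y"
      using less z by blast
  next
    assume w: "w = V *\<^sub>v y"
    have "\<not> ?f w' < ?f (V *\<^sub>v y)" if "w' \<in> K" for w'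
    proof -
      obtain z where z: "z \<in> carrier_vec k" "w' = V *\<^sub>v z"
        using \<open>w' \<in> K\<close> unfolding krylov_eq by blast
      show ?thesis
      proof (cases "z = y")
        case False
        then show ?thesis
          using less[OF z(1)] z(2) by (simp only: not_less order_less_imp_le not_False_eq_True)
      qed (use z(2) in \<open>simp only: less_irrefl not_False_eq_True\<close>)
    qed
    then show "is_arg_min ?f (\<lambda>w. w \<in> K) w"
      using yK unfolding is_arg_min_def w by blast
  qed
  then show ?thesis
    by (simp add: sketch_proj_def arg_min_on_def arg_min_def)
qed

lemma A_mult_basis:
  assumes y: "y \<in> carrier_vec k"
  shows "A *\<^sub>v (V *\<^sub>v y) = V *\<^sub>v (H *\<^sub>v y) + y $ (k - 1) \<cdot>\<^sub>v r"
proof -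
  let ?U = "outer r (unit_vec k (k - 1))"
  have U: "?U \<in> carrier_mat n k"
    using r by (auto simp: outer_def intro!: mult_carrier_mat)
  have "A *\<^sub>v (V *\<^sub>v y) = (A * V) *\<^sub>v y"
    using y by (simp add: assoc_mult_mat_vec[OF A V])
  also have "A * V = V * H + ?U"
    using arnoldi by (simp add: rand_arnoldi_def)
  also have "(V * H + ?U) *\<^sub>v y = V * H *\<^sub>v y + ?U *\<^sub>v y"
    by (rule add_mult_distrib_mat_vec[OF mult_carrier_mat[OF V H] U y])
  also have "\<dots> = V *\<^sub>v (H *\<^sub>v y) + y $ (k - 1) \<cdot>\<^sub>v r"
    using y k_pos outer_mult_unit_vec[OF r y, of "k - 1"] by (simp add: assoc_mult_mat_vec[OF V H])
  finally show ?thesis .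
qed

lemma v1_eq: "v1 = V *\<^sub>v e1"
proof -
  have "v1 = col V 0"
    using arnoldi by (simp add: rand_arnoldi_def)
  also have "\<dots> = V *\<^sub>v e1"
    using k_pos by (intro eq_vecI) auto
  finally show ?thesis .
qed

text \<open>Unless \<open>r = 0\<close>, the bound \<open>l < k\<close> is sharp: the step from \<open>l\<close> to \<open>l + 1\<close> adds the last entry of \<open>H\<^sup>l e\<^sub>1\<close> times \<open>r\<close>,
  and this entry is positive for the first time at \<open>l = k - 1\<close>.\<close>

lemma krylov_pow: "l < k \<Longrightarrow> A ^\<^sub>m l *\<^sub>v v1 = V *\<^sub>v (H ^\<^sub>m l *\<^sub>v e1)"
proof (induction l)
  case 0
  then show ?case
    by (simp add: v1_eq[symmetric])
next
  case (Suc l)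
  let ?w = "H ^\<^sub>m l *\<^sub>v e1"
  have w: "?w \<in> carrier_vec k"
    by (rule pow_mat_mult_vec_carrier[OF H unit_vec_carrier])
  have last: "?w $ (k - 1) = 0"
    using hessenberg_krylov_triangular[OF H hess, of l] Suc.prems by auto
  have "A ^\<^sub>m Suc l *\<^sub>v v1 = A *\<^sub>v (V *\<^sub>v ?w)"
    using Suc by (simp add: pow_mat_Suc_mult_vec[OF A v1] del: pow_mat.simps)
  also have "\<dots> = V *\<^sub>v (H *\<^sub>v ?w)"
    unfolding A_mult_basis[OF w] last
    by (rule add_zero_smult_r[OF V_mult_carrier[OF mult_mat_vec_carrier[OF H w]]])
  also have "H *\<^sub>v ?w = H ^\<^sub>m Suc l *\<^sub>v e1"
    by (rule pow_mat_Suc_mult_vec[OF H unit_vec_carrier, symmetric])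
  finally show ?case .
qed

text \<open>The product of the subdiagonal entries of \<open>H\<close>.\<close>

definition residual_weight :: real where
  "residual_weight = (H ^\<^sub>m (k - 1) *\<^sub>v e1) $ (k - 1)"

lemma krylov_pow_k: "A ^\<^sub>m k *\<^sub>v v1 = V *\<^sub>v (H ^\<^sub>m k *\<^sub>v e1) + residual_weight \<cdot>\<^sub>v r"
proof -
  let ?w = "H ^\<^sub>m (k - 1) *\<^sub>v e1"
  have w: "?w \<in> carrier_vec k"
    by (rule pow_mat_mult_vec_carrier[OF H unit_vec_carrier])
  have "A ^\<^sub>m k *\<^sub>v v1 = A *\<^sub>v (A ^\<^sub>m (k - 1) *\<^sub>v v1)"
    "H ^\<^sub>m k *\<^sub>v e1 = H *\<^sub>v ?w"
    using k_pos pow_mat_Suc_mult_vec[OF A v1, of "k - 1"]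
      pow_mat_Suc_mult_vec[OF H unit_vec_carrier, of "k - 1" 0] by simp_all
  then show ?thesis
    using krylov_pow[of "k - 1"] k_pos A_mult_basis[OF w] by (simp add: residual_weight_def)
qed

text \<open>Only the leading term of \<open>p\<close> reaches the residual, so that being monic fixes the multiple of \<open>r\<close>:
  the choice of \<open>p\<close> affects the component in the Krylov space alone.\<close>

lemma monic_poly_mult_start:
  assumes p: "p \<in> monic_polys k"
  shows "mat_poly n p A *\<^sub>v v1 = V *\<^sub>v (mat_poly k p H *\<^sub>v e1) + residual_weight \<cdot>\<^sub>v r"
proof (rule eq_vecI)
  fix i assume "i < dim_vec (V *\<^sub>v (mat_poly k p H *\<^sub>v e1) + residual_weight \<cdot>\<^sub>v r)"
  then have i: "i < n" by simp
  let ?h = "\<lambda>l. H ^\<^sub>m l *\<^sub>v e1"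
  have h: "?h l \<in> carrier_vec k" for l
    by (rule pow_mat_mult_vec_carrier[OF H unit_vec_carrier])
  have deg: "degree p = k" "coeff p k = 1"
    using p by (auto simp: monic_polys_def)
  have "(mat_poly n p A *\<^sub>v v1) $ i = (\<Sum>l\<le>k. coeff p l * (A ^\<^sub>m l *\<^sub>v v1) $ i)"
    by (simp add: index_mat_poly_mult_vec[OF A v1 i] umbral_def deg)
  also have "\<dots> = (\<Sum>l\<le>k. coeff p l * (V *\<^sub>v ?h l) $ i + (if l = k then residual_weight * r $ i else 0))"
  proof (intro sum.cong refl)
    fix l assume "l \<in> {..k}"
    then show "coeff p l * (A ^\<^sub>m l *\<^sub>v v1) $ i =
        coeff p l * (V *\<^sub>v ?h l) $ i + (if l = k then residual_weight * r $ i else 0)"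
      using krylov_pow[of l] krylov_pow_k i deg
      by (cases "l = k") (simp_all del: pow_mat.simps)
  qed
  also have "\<dots> = umbral (\<lambda>l. (V *\<^sub>v ?h l) $ i) p + residual_weight * r $ i"
    by (simp add: sum.distrib umbral_def deg)
  also have "umbral (\<lambda>l. (V *\<^sub>v ?h l) $ i) p = (\<Sum>m<k. V $$ (i, m) * umbral (\<lambda>l. ?h l $ m) p)"
    by (simp add: index_mult_mat_vec_sum[OF V h i] umbral_linear_combination)
  also have "\<dots> = (V *\<^sub>v (mat_poly k p H *\<^sub>v e1)) $ i"
    by (simp add: index_mult_mat_vec_sum[OF V mult_mat_vec_carrier[OF mat_poly_carrier unit_vec_carrier] i]
        index_mat_poly_mult_vec[OF H unit_vec_carrier])
  finally show "(mat_poly n p A *\<^sub>v v1) $ i = (V *\<^sub>v (mat_poly k p H *\<^sub>v e1) + residual_weight \<cdot>\<^sub>v r) $ i"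
    using i by simp
qed (simp add: mat_poly_def)

lemma sketch_norm_monic_poly:
  assumes "p \<in> monic_polys k"
  shows "(Om *\<^sub>v (mat_poly n p A *\<^sub>v v1)) \<bullet> (Om *\<^sub>v (mat_poly n p A *\<^sub>v v1)) =
    (mat_poly k p H *\<^sub>v e1) \<bullet> (mat_poly k p H *\<^sub>v e1) + residual_weight\<^sup>2 * ((Om *\<^sub>v r) \<bullet> (Om *\<^sub>v r))"
  unfolding monic_poly_mult_start[OF assms]
  by (rule sketch_norm_split) (rule mult_mat_vec_carrier[OF mat_poly_carrier unit_vec_carrier])

lemma char_poly_is_unique_arg_min:
  "is_arg_min (\<lambda>q. euclid_norm (Om *\<^sub>v (mat_poly n q A *\<^sub>v v1))) (\<lambda>q. q \<in> monic_polys k) p \<longleftrightarrow>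
    p = char_poly H"
proof -
  let ?f = "\<lambda>q. euclid_norm (Om *\<^sub>v (mat_poly n q A *\<^sub>v v1))"
  let ?w = "\<lambda>q. mat_poly k q H *\<^sub>v e1"
  have less: "?f q < ?f q' \<longleftrightarrow> ?w q \<bullet> ?w q < ?w q' \<bullet> ?w q'"
    if "q \<in> monic_polys k" "q' \<in> monic_polys k" for q q'
    by (simp add: euclid_norm_less_iff sketch_norm_monic_poly that)
  have chi: "char_poly H \<in> monic_polys k"
    by (rule char_poly_in_monic_polys[OF H])
  have chi0: "?w (char_poly H) \<bullet> ?w (char_poly H) = 0"
    by (simp add: char_poly_annihilates[OF H])
  have pos: "0 < ?w q \<bullet> ?w q" if "q \<in> monic_polys k" "q \<noteq> char_poly H" for q
  proof -
    have "?w q \<noteq> 0\<^sub>v k"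
      using monic_annihilator_eq_char_poly[OF H hess that(1) k_pos] that(2) by auto
    then show ?thesis
      using scalar_prod_self_eq_0_iff[of "?w q" k] scalar_prod_self_nonneg[of "?w q"]
      by (metis mat_poly_carrier mult_mat_vec_carrier order_le_less unit_vec_carrier)
  qed
  show ?thesis
  proof
    assume "is_arg_min ?f (\<lambda>q. q \<in> monic_polys k) p"
    then have p: "p \<in> monic_polys k" and "\<not> ?f (char_poly H) < ?f p"
      using chi by (auto simp: is_arg_min_def)
    then show "p = char_poly H"
      using less[OF chi p] chi0 pos by auto
  next
    assume "p = char_poly H"
    then show "is_arg_min ?f (\<lambda>q. q \<in> monic_polys k) p"
      using chi less[OF _ chi] chi0 scalar_prod_self_nonneg
      by (simp add: is_arg_min_def) (metis not_less)
  qed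
qed

lemma compression_eq_H:
  assumes y: "y \<in> carrier_vec k"
  shows "sketch_proj Om K (A *\<^sub>v sketch_proj Om K (V *\<^sub>v y)) = V *\<^sub>v (H *\<^sub>v y)"
proof -
  have "sketch_proj Om K (V *\<^sub>v y) = V *\<^sub>v y"
    using sketch_proj_eq[OF y, of 0] y by simp
  then show ?thesis
    using y by (simp add: A_mult_basis[OF y] sketch_proj_eq mult_mat_vec_carrier[OF H])
qed

end

theorem theorem5p2:
  fixes n d k :: nat and eps :: real and Om A V H :: "real mat" and v1 r :: "real vec"
  assumes "rand_arnoldi n d k eps Om A v1 V H r"
  shows "(\<forall>x y. y \<in> carrier_vec k \<and> x = V *\<^sub>v y \<longrightarrow>
            sketch_proj Om (krylov n A v1 k)
              (A *\<^sub>v sketch_proj Om (krylov n A v1 k) x) = V *\<^sub>v (H *\<^sub>v y)) \<and>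
         (\<forall>p. is_arg_min (\<lambda>q. euclid_norm (Om *\<^sub>v (mat_poly n q A *\<^sub>v v1)))
                (\<lambda>q. q \<in> monic_polys k) p \<longleftrightarrow> p = char_poly H)"
proof -
  interpret randomized_arnoldi n d k eps Om A V H v1 r
    using assms by unfold_locales
  show ?thesis
    using compression_eq_H char_poly_is_unique_arg_min by blast
qed

end
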